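(* Let $t\geq 1$ and $n\geq 1$ be integers and let $0<\alpha<1$ be such that the pair $(n,\alpha)$ is feasible, that is, $\lceil(1-\alpha)(n+1)\rceil\leq n$. Let the data sequence $(X_{-t+1},Y_{-t+1}),\dots,(X_0,Y_0),(X_1,Y_1),(X_2,Y_2),\dots$ be exchangeable, and let $\rho$ be a conformity function that is regular with respect to this data sequence. Then the empirical coverage $C^{(n,\alpha)}_m$ converges almost surely, as the future batch size $m$ tends to infinity, to a random variable $C^{(n,\alpha)}_\infty$ with distribution $\text{Beta}(\lceil(1-\alpha)(n+1)\rceil,\lfloor\alpha(n+1)\rfloor)$.
   Context: Let $(\Omega,\mathscr{F},P)$ be a probability space on which all random objects are defined. A sequence of random objects is exchangeable if, for every $N\geq 1$, the joint distribution of its first $N$ terms is invariant under every permutation of those $N$ terms. For real $s$, $\lceil s\rceil$ and $\lfloor s\rfloor$ denote the ceiling and the floor of $s$. Let $d\geq 1$, and let $\mathscr{Y}$ be either $\mathbb{R}$ (regression) or a finite set of class labels $\{1,\dots,L\}$ (classification). The data sequence consists of random pairs $(X_i,Y_i)$ taking values in $\mathbb{R}^d\times\mathscr{Y}$, indexed by the integers $i\geq -t+1$. Here $T=((X_{-t+1},Y_{-t+1}),\dots,(X_0,Y_0))$ is the training sample, $((X_1,Y_1),\dots,(X_n,Y_n))$ is the calibration sample, and $\{(X_{n+i},Y_{n+i})\}_{i\geq 1}$ is the sequence of future observables. Exchangeability of the data sequence refers to the whole sequence, including the training sample. Let $\mathscr{T}=\sigma(T)$ be the smallest sub-$\sigma$-field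 of $\mathscr{F}$ with respect to which $T$ is measurable. A conformity function is a mapping $\rho:\mathbb{R}^d\times\mathscr{Y}\times\Omega\to\mathbb{R}$ such that $\omega\mapsto\rho(x,y,\omega)$ is $\mathscr{T}$-measurable for every $x\in\mathbb{R}^d$ and every $y\in\mathscr{Y}$. The associated conformity scores are $S_i(\omega)=\rho(X_i(\omega),Y_i(\omega),\omega)$, $i\geq 1$. The conformity function $\rho$ is regular with respect to the data sequence if almost surely there are no ties among $\{S_i\}_{i\geq 1}$. Let $S_{(1)},\dots,S_{(n)}$ be the calibration sample conformity scores $S_1,\dots,S_n$ arranged in increasing order. The number $\alpha$ is the nominal miscoverage level. The random conformal prediction set is $$D^{(\alpha)}_n(x,\omega)=\left\{y\in\mathscr{Y}:\rho(x,y,\omega)\leq S_{(\lceil(1-\alpha)(n+1)\rceil)}(\omega)\right\},$$ and $D^{(\alpha)}_n(x)=D^{(\alpha)}_n(x,\cdot)$. The coverage indicators are $Z_i=1$ if $Y_{n+i}\in D^{(\alpha)}_n(X_{n+i})$ and $Z_i=0$ otherwise, for $i\geq 1$. The empirical coverage of a batch of $m\geq 1$ future observables is $C^{(n,\alpha)}_m=\frac{1}{m}\sum_{i=1}^m Z_i$.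
   Formalization: The conformity function ρ is additionally assumed to be jointly measurable in (x,y,ω) with respect to the Borel sets and σ(T); with measurability in ω only for each fixed (x,y), the claim fails for a non-measurable ρ. *)

theory Defs
  imports "HOL-Probability.Probability"
begin

text \<open>
  \<open>exchangeable M S W\<close>: the \<open>S\<close>-valued random objects \<open>W 0, W 1, \<dots>\<close> on \<open>M\<close> form an
  exchangeable sequence. Measurability of each term is part of the notion.
\<close>

definition exchangeable :: "'w measure \<Rightarrow> 'a measure \<Rightarrow> (nat \<Rightarrow> 'w \<Rightarrow> 'a) \<Rightarrow> bool" where
  "exchangeable M S W \<longleftrightarrow>
     (\<forall>j. W j \<in> measurable M S) \<and>
     (\<forall>N\<ge>1. \<forall>\<pi>. \<pi> permutes {..<N} \<longrightarrow>
        distr M (PiM {..<N} (\<lambda>_. S)) (\<lambda>\<omega>. \<lambda>j\<in>{..<N}. W (\<pi> j) \<omega>) =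
        distr M (PiM {..<N} (\<lambda>_. S)) (\<lambda>\<omega>. \<lambda>j\<in>{..<N}. W j \<omega>))"

text \<open>
  Regression and classification are treated together by letting the response space be a set of
  reals; the class labels \<open>1, \<dots>, L\<close> are the corresponding real numbers. On a finite set of labels
  the restricted Borel algebra is the discrete one.
\<close>

definition response_space :: "real set \<Rightarrow> bool" where
  "response_space \<Y> \<longleftrightarrow> \<Y> = UNIV \<or> (\<exists>L::nat. L \<ge> 1 \<and> \<Y> = real ` {1..L})"

definition response_algebra :: "real set \<Rightarrow> real measure" where
  "response_algebra \<Y> = restrict_space borel \<Y>"

definition pair_algebra :: "real set \<Rightarrow> ((real ^ 'd) \<times> real) measure" where
  "pair_algebra \<Y> = borel \<Otimes>\<^sub>M response_algebra \<Y>"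

text \<open>
  The data are families \<open>X\<close>, \<open>Y\<close> indexed by integers; only the indices \<open>i \<ge> - t + 1\<close> matter, and
  \<open>data_seq t X Y\<close> enumerates the pairs starting from the first such index.
\<close>

definition data_seq ::
  "nat \<Rightarrow> (int \<Rightarrow> 'w \<Rightarrow> real ^ 'd) \<Rightarrow> (int \<Rightarrow> 'w \<Rightarrow> real) \<Rightarrow> nat \<Rightarrow> 'w \<Rightarrow> (real ^ 'd) \<times> real" where
  "data_seq t X Y j \<omega> = (X (- int t + 1 + int j) \<omega>, Y (- int t + 1 + int j) \<omega>)"

definition training_sample ::
  "nat \<Rightarrow> (int \<Rightarrow> 'w \<Rightarrow> real ^ 'd) \<Rightarrow> (int \<Rightarrow> 'w \<Rightarrow> real) \<Rightarrow> 'w \<Rightarrow> int \<Rightarrow> (real ^ 'd) \<times> real" where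
  "training_sample t X Y \<omega> = (\<lambda>i\<in>{- int t + 1..0}. (X i \<omega>, Y i \<omega>))"

definition training_algebra ::
  "'w measure \<Rightarrow> real set \<Rightarrow> nat \<Rightarrow> (int \<Rightarrow> 'w \<Rightarrow> real ^ 'd) \<Rightarrow> (int \<Rightarrow> 'w \<Rightarrow> real) \<Rightarrow> 'w measure" where
  "training_algebra M \<Y> t X Y =
     vimage_algebra (space M) (training_sample t X Y)
       (PiM {- int t + 1..0} (\<lambda>_. pair_algebra \<Y>))"

definition conformity_function ::
  "'w measure \<Rightarrow> real set \<Rightarrow> nat \<Rightarrow> (int \<Rightarrow> 'w \<Rightarrow> real ^ 'd) \<Rightarrow> (int \<Rightarrow> 'w \<Rightarrow> real) \<Rightarrow>
     (real ^ 'd \<Rightarrow> real \<Rightarrow> 'w \<Rightarrow> real) \<Rightarrow> bool" where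
  "conformity_function M \<Y> t X Y \<rho> \<longleftrightarrow>
     (\<forall>x. \<forall>y\<in>\<Y>. (\<lambda>\<omega>. \<rho> x y \<omega>) \<in> borel_measurable (training_algebra M \<Y> t X Y))"

text \<open>
  Measurability in \<open>\<omega>\<close> for each fixed \<open>(x, y)\<close> does not make \<open>\<rho> (X i \<omega>) (Y i \<omega>) \<omega>\<close> a random
  variable, nor does it make the scores inherit exchangeability from the data (a non-measurable
  \<open>\<rho>\<close> that does not depend on \<open>\<omega>\<close> is enough to break both). The joint measurability that is
  understood whenever \<open>\<rho>\<close> is evaluated at the data is therefore stated separately.
\<close>

definition jointly_measurable ::
  "'w measure \<Rightarrow> real set \<Rightarrow> nat \<Rightarrow> (int \<Rightarrow> 'w \<Rightarrow> real ^ 'd) \<Rightarrow> (int \<Rightarrow> 'w \<Rightarrow> real) \<Rightarrow>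
     (real ^ 'd \<Rightarrow> real \<Rightarrow> 'w \<Rightarrow> real) \<Rightarrow> bool" where
  "jointly_measurable M \<Y> t X Y \<rho> \<longleftrightarrow>
     (\<lambda>((x, y), \<omega>). \<rho> x y \<omega>) \<in>
       borel_measurable (pair_algebra \<Y> \<Otimes>\<^sub>M training_algebra M \<Y> t X Y)"

definition conformity_score ::
  "(int \<Rightarrow> 'w \<Rightarrow> real ^ 'd) \<Rightarrow> (int \<Rightarrow> 'w \<Rightarrow> real) \<Rightarrow> (real ^ 'd \<Rightarrow> real \<Rightarrow> 'w \<Rightarrow> real) \<Rightarrow>
     int \<Rightarrow> 'w \<Rightarrow> real" where
  "conformity_score X Y \<rho> i \<omega> = \<rho> (X i \<omega>) (Y i \<omega>) \<omega>"

definition regular_conformity ::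
  "'w measure \<Rightarrow> (int \<Rightarrow> 'w \<Rightarrow> real ^ 'd) \<Rightarrow> (int \<Rightarrow> 'w \<Rightarrow> real) \<Rightarrow>
     (real ^ 'd \<Rightarrow> real \<Rightarrow> 'w \<Rightarrow> real) \<Rightarrow> bool" where
  "regular_conformity M X Y \<rho> \<longleftrightarrow>
     (AE \<omega> in M. \<forall>i\<ge>1. \<forall>j\<ge>1. i \<noteq> j \<longrightarrow>
        conformity_score X Y \<rho> i \<omega> \<noteq> conformity_score X Y \<rho> j \<omega>)"

definition quantile_rank :: "nat \<Rightarrow> real \<Rightarrow> int" where
  "quantile_rank n \<alpha> = \<lceil>(1 - \<alpha>) * (real n + 1)\<rceil>"

definition feasible :: "nat \<Rightarrow> real \<Rightarrow> bool" where
  "feasible n \<alpha> \<longleftrightarrow> quantile_rank n \<alpha> \<le> int n"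

text \<open>
  \<open>calibration_order_stat n X Y \<rho> k \<omega>\<close> is \<open>S\<^sub>(\<^sub>k\<^sub>)\<close>, meaningful for \<open>1 \<le> k \<le> n\<close>; list positions
  start at 0.
\<close>

definition calibration_order_stat ::
  "nat \<Rightarrow> (int \<Rightarrow> 'w \<Rightarrow> real ^ 'd) \<Rightarrow> (int \<Rightarrow> 'w \<Rightarrow> real) \<Rightarrow> (real ^ 'd \<Rightarrow> real \<Rightarrow> 'w \<Rightarrow> real) \<Rightarrow>
     int \<Rightarrow> 'w \<Rightarrow> real" where
  "calibration_order_stat n X Y \<rho> k \<omega> =
     sort (map (\<lambda>i. conformity_score X Y \<rho> i \<omega>) [1..int n]) ! nat (k - 1)"

definition prediction_set ::
  "real set \<Rightarrow> nat \<Rightarrow> real \<Rightarrow> (int \<Rightarrow> 'w \<Rightarrow> real ^ 'd) \<Rightarrow> (int \<Rightarrow> 'w \<Rightarrow> real) \<Rightarrow>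
     (real ^ 'd \<Rightarrow> real \<Rightarrow> 'w \<Rightarrow> real) \<Rightarrow> real ^ 'd \<Rightarrow> 'w \<Rightarrow> real set" where
  "prediction_set \<Y> n \<alpha> X Y \<rho> x \<omega> =
     {y \<in> \<Y>. \<rho> x y \<omega> \<le> calibration_order_stat n X Y \<rho> (quantile_rank n \<alpha>) \<omega>}"

definition coverage_indicator ::
  "real set \<Rightarrow> nat \<Rightarrow> real \<Rightarrow> (int \<Rightarrow> 'w \<Rightarrow> real ^ 'd) \<Rightarrow> (int \<Rightarrow> 'w \<Rightarrow> real) \<Rightarrow>
     (real ^ 'd \<Rightarrow> real \<Rightarrow> 'w \<Rightarrow> real) \<Rightarrow> nat \<Rightarrow> 'w \<Rightarrow> real" where
  "coverage_indicator \<Y> n \<alpha> X Y \<rho> i \<omega> =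
     (if Y (int n + int i) \<omega> \<in> prediction_set \<Y> n \<alpha> X Y \<rho> (X (int n + int i) \<omega>) \<omega> then 1 else 0)"

definition empirical_coverage ::
  "real set \<Rightarrow> nat \<Rightarrow> real \<Rightarrow> (int \<Rightarrow> 'w \<Rightarrow> real ^ 'd) \<Rightarrow> (int \<Rightarrow> 'w \<Rightarrow> real) \<Rightarrow>
     (real ^ 'd \<Rightarrow> real \<Rightarrow> 'w \<Rightarrow> real) \<Rightarrow> nat \<Rightarrow> 'w \<Rightarrow> real" where
  "empirical_coverage \<Y> n \<alpha> X Y \<rho> m \<omega> =
     (\<Sum>i=1..m. coverage_indicator \<Y> n \<alpha> X Y \<rho> i \<omega>) / real m"

definition beta_density :: "real \<Rightarrow> real \<Rightarrow> real \<Rightarrow> real" where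
  "beta_density a b x =
     (if 0 < x \<and> x < 1 then x powr (a - 1) * (1 - x) powr (b - 1) / Beta a b else 0)"

end

theory Submission
  imports Defs "HOL-Real_Asymp.Real_Asymp"
begin

text \<open>
  Put \<open>k = \<lceil>(1 - \<alpha>)(n + 1)\<rceil>\<close> and \<open>b = n + 1 - k\<close>. Since \<open>\<rho>\<close> depends on \<open>\<omega>\<close> only through the
  training sample, the scores are exchangeable. The future scores with index in a set \<open>A\<close> are all at
  most \<open>S\<^sub>(\<^sub>k\<^sub>)\<close> iff the \<open>b\<close> largest of the \<open>n + |A|\<close> scores involved are calibration scores; as the
  set of the \<open>b\<close> largest is uniformly distributed over the \<open>b\<close>-subsets, this event has probability
  \<open>(n choose b) / (n + |A| choose b) = Beta (k + |A|) b / Beta k b\<close>. Constant pair probabilities give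
  \<open>E (C\<^sub>l - C\<^sub>m)\<^sup>2 = (p\<^sub>1 - p\<^sub>2)(1/m - 1/l)\<close>, hence almost sure convergence along the cubes and then,
  by monotonicity of the sums, along all \<open>m\<close>. With \<open>N\<^sub>m\<close> the number of covered observables among the
  first \<open>m\<close>, the ratio \<open>(N\<^sub>m choose r) / (m choose r)\<close> has mean \<open>p\<^sub>r\<close> and tends to \<open>C\<^sup>r\<close>, so the limit
  has the moments of the Beta law, which determine it because it has bounded support.
\<close>

subsection \<open>Averages of exchangeable indicators\<close>

text \<open>The second moment bounds used later control only the cubes. Monotonicity fills the gaps:
  with \<open>q\<close> the integer cube root of \<open>m\<close>, the average at \<open>m\<close>
  lies between \<open>s (q ^ 3) / (q + 1) ^ 3\<close> and
  \<open>s ((q + 1) ^ 3) / q ^ 3\<close>.\<close>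

lemma averages_tendsto_of_cubes:
  fixes s :: "nat \<Rightarrow> real"
  assumes mono: "mono s" and nonneg: "\<And>m. 0 \<le> s m"
    and lim: "(\<lambda>j. s (j ^ 3) / real (j ^ 3)) \<longlonglongrightarrow> c"
  shows "(\<lambda>m. s m / real m) \<longlonglongrightarrow> c"
proof -
  define q where "q m = nat \<lfloor>root 3 (real m)\<rfloor>" for m :: nat
  have q_lim: "filterlim q sequentially sequentially"
    unfolding q_def by real_asymp
  have q_le: "q m ^ 3 \<le> m" for m
  proof -
    have "real (q m) \<le> root 3 (real m)" by (simp add: q_def)
    then have "real (q m) ^ 3 \<le> root 3 (real m) ^ 3" by (intro power_mono) auto
    then have "real (q m ^ 3) \<le> real m" by simp
    then show ?thesis by (simp only: of_nat_le_iff)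
  qed
  have q_ge: "m \<le> Suc (q m) ^ 3" for m
  proof -
    have "root 3 (real m) \<le> real (Suc (q m))" by (simp add: q_def) linarith
    then have "root 3 (real m) ^ 3 \<le> real (Suc (q m)) ^ 3" by (intro power_mono) auto
    then have "real m \<le> real (Suc (q m) ^ 3)" by simp
    then show ?thesis by (simp only: of_nat_le_iff)
  qed
  \<comment> \<open>The monotone sums are squeezed between consecutive cubes, whose ratio tends to 1.\<close>
  have "(\<lambda>j. (s (j ^ 3) / real (j ^ 3)) * (real (j ^ 3) / real (Suc j ^ 3))) \<longlonglongrightarrow> c * 1"
    by (intro tendsto_mult lim) real_asymp
  then have lo: "(\<lambda>m. (s (q m ^ 3) / real (q m ^ 3)) * (real (q m ^ 3) / real (Suc (q m) ^ 3))) \<longlonglongrightarrow> c"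
    using filterlim_compose[OF _ q_lim] by fastforce
  have "(\<lambda>j. (s (Suc j ^ 3) / real (Suc j ^ 3)) * (real (Suc j ^ 3) / real (j ^ 3))) \<longlonglongrightarrow> c * 1"
    by (intro tendsto_mult LIMSEQ_Suc[OF lim]) real_asymp
  then have hi: "(\<lambda>m. (s (Suc (q m) ^ 3) / real (Suc (q m) ^ 3)) * (real (Suc (q m) ^ 3) / real (q m ^ 3))) \<longlonglongrightarrow> c"
    using filterlim_compose[OF _ q_lim] by fastforce
  have ev: "eventually (\<lambda>m. 0 < q m) sequentially"
    using q_lim eventually_gt_at_top filterlim_iff by blast
  show ?thesis
  proof (rule tendsto_sandwich[OF _ _ lo hi])
    show "eventually (\<lambda>m. s (q m ^ 3) / real (q m ^ 3) * (real (q m ^ 3) / real (Suc (q m) ^ 3)) \<le> s m / real m) sequentially"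
      using ev
    proof eventually_elim
      case (elim m)
      have "0 < m" using q_le[of m] elim by (metis gr0I le_zero_eq power_eq_0_iff less_not_refl)
      have "s (q m ^ 3) / real (q m ^ 3) * (real (q m ^ 3) / real (Suc (q m) ^ 3)) = s (q m ^ 3) / real (Suc (q m) ^ 3)"
        using elim by simp
      also have "\<dots> \<le> s m / real m"
        using monoD[OF mono q_le[of m]] q_ge[of m] nonneg \<open>0 < m\<close>
        by (intro frac_le) (simp_all only: of_nat_le_iff of_nat_0_less_iff)
      finally show ?case .
    qed
    show "eventually (\<lambda>m. s m / real m \<le> s (Suc (q m) ^ 3) / real (Suc (q m) ^ 3) * (real (Suc (q m) ^ 3) / real (q m ^ 3))) sequentially"
      using ev
    proof eventually_elim
      case (elim m)
      have "s m / real m \<le> s (Suc (q m) ^ 3) / real (q m ^ 3)"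
        using monoD[OF mono q_ge[of m]] q_le[of m] nonneg elim
        by (intro frac_le) (simp_all only: of_nat_le_iff of_nat_0_less_iff zero_less_power)
      also have "\<dots> = s (Suc (q m) ^ 3) / real (Suc (q m) ^ 3) * (real (Suc (q m) ^ 3) / real (q m ^ 3))"
        by (simp del: of_nat_Suc of_nat_power power_Suc)
      finally show ?case .
    qed
  qed
qed

context prob_space begin

text \<open>Expand the square. The mixed moments are linear in \<open>p1\<close> and
  \<open>p2\<close>, and only \<open>p1 - p2\<close> survives, in the place that the variance has
  for independent terms.\<close>

lemma expectation_average_diff_square:
  assumes E: "\<And>i. E i \<in> events"
    and p1: "\<And>i. prob (E i) = p1" and p2: "\<And>i j. i \<noteq> j \<Longrightarrow> prob (E i \<inter> E j) = p2"
    and m: "0 < m" "m \<le> l"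
  defines "S \<equiv> \<lambda>m \<omega>. (\<Sum>i<m. indicator (E i) \<omega> :: real)"
  shows "expectation (\<lambda>\<omega>. (S l \<omega> / real l - S m \<omega> / real m)\<^sup>2) = (p1 - p2) * (1 / real m - 1 / real l)"
proof -
  have E'[measurable]: "E i \<in> events" for i using E .
  have int: "integrable M (\<lambda>\<omega>. S a \<omega> * S b \<omega>)" for a b
    unfolding S_def sum_product by (auto simp: indicator_inter_arith[symmetric] less_top[symmetric])
  \<comment> \<open>For \<open>a \<le> b\<close> each \<open>i < a\<close> meets itself once and
    \<open>b - 1\<close> other indices.\<close>
  have *: "expectation (\<lambda>\<omega>. S a \<omega> * S b \<omega>) = real a * (p1 + (real b - 1) * p2)" if "a \<le> b" for a b
  proof -
    have "expectation (\<lambda>\<omega>. S a \<omega> * S b \<omega>) = (\<Sum>i<a. \<Sum>j<b. prob (E i \<inter> E j))"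
      unfolding S_def sum_product
      by (subst Bochner_Integration.integral_sum)
        (auto simp: indicator_inter_arith[symmetric] less_top[symmetric] Bochner_Integration.integral_sum intro!: sum.cong)
    also have "\<dots> = (\<Sum>i<a. p1 + (real b - 1) * p2)"
    proof (rule sum.cong[OF refl])
      fix i assume "i \<in> {..<a}"
      with that have i: "i \<in> {..<b}" by auto
      have "(\<Sum>j<b. prob (E i \<inter> E j)) = prob (E i \<inter> E i) + (\<Sum>j\<in>{..<b}-{i}. prob (E i \<inter> E j))"
        using i by (intro sum.remove) auto
      also have "(\<Sum>j\<in>{..<b}-{i}. prob (E i \<inter> E j)) = (\<Sum>j\<in>{..<b}-{i}. p2)"
        by (intro sum.cong refl p2) auto
      finally show "(\<Sum>j<b. prob (E i \<inter> E j)) = p1 + (real b - 1) * p2"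
        using i p1 by (simp add: of_nat_diff)
    qed
    finally show ?thesis by simp
  qed
  have l: "0 < l" using m by simp
  have "expectation (\<lambda>\<omega>. (S l \<omega> / real l - S m \<omega> / real m)\<^sup>2) =
      expectation (\<lambda>\<omega>. (1 / real l ^ 2) * (S l \<omega> * S l \<omega>) + (1 / real m ^ 2) * (S m \<omega> * S m \<omega>)
         - (2 / (real m * real l)) * (S m \<omega> * S l \<omega>))"
    using m l by (intro Bochner_Integration.integral_cong) (auto simp: power2_eq_square divide_inverse algebra_simps)
  also have "\<dots> = (1 / real l ^ 2) * (real l * (p1 + (real l - 1) * p2)) + (1 / real m ^ 2) * (real m * (p1 + (real m - 1) * p2))
         - (2 / (real m * real l)) * (real m * (p1 + (real l - 1) * p2))"
    using int m by (simp add: *)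
  also have "\<dots> = (p1 - p2) * (1 / real m - 1 / real l)"
    using m l by (simp add: divide_simps power2_eq_square) (simp add: algebra_simps)
  finally show ?thesis .
qed

text \<open>Consecutive averages along the cubes differ by \<open>D j\<close>, whose second moment
  is at most \<open>3 / x ^ 4\<close> with \<open>x = Suc j\<close>. The series of
  \<open>x ^ 2 * (D j) ^ 2\<close> therefore has finite mean and is finite almost surely, which
  makes \<open>D j\<close> absolutely summable.\<close>

lemma AE_convergent_averages:
  assumes E: "\<And>i. E i \<in> events"
    and p1: "\<And>i. prob (E i) = p1" and p2: "\<And>i j. i \<noteq> j \<Longrightarrow> prob (E i \<inter> E j) = p2"
  shows "AE \<omega> in M. convergent (\<lambda>m. (\<Sum>i<m. indicator (E i) \<omega> :: real) / real m)"
proof -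
  define S where "S = (\<lambda>m \<omega>. (\<Sum>i<m. indicator (E i) \<omega> :: real))"
  have [measurable]: "E i \<in> events" for i using E .
  have [measurable]: "S m \<in> borel_measurable M" for m unfolding S_def by measurable
  \<comment> \<open>The cubes start at 1, so no average is over an empty batch.\<close>
  define D where "D j \<omega> = S (Suc (Suc j) ^ 3) \<omega> / real (Suc (Suc j) ^ 3) - S (Suc j ^ 3) \<omega> / real (Suc j ^ 3)" for j \<omega>
  have [measurable]: "D j \<in> borel_measurable M" for j unfolding D_def by measurable
  have "p1 - p2 \<le> 1" using p1[of 0] p2[of 0 1] prob_le_1[of "E 0"] measure_nonneg[of M "E 0 \<inter> E 1"] by simp
  have S_bd: "0 \<le> S m \<omega>" "S m \<omega> \<le> real m" for m \<omega>
    unfolding S_def using sum_bounded_above[of "{..<m}" "\<lambda>i. indicator (E i) \<omega> :: real" 1]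
    by (auto intro: sum_nonneg)
  have avg_bd: "0 \<le> S m \<omega> / real m" "S m \<omega> / real m \<le> 1" for m \<omega>
    using S_bd[of m \<omega>] by (auto simp: divide_simps)
  have D_bd: "\<bar>D j \<omega>\<bar> \<le> 1" for j \<omega>
    unfolding D_def using avg_bd[of "Suc (Suc j) ^ 3" \<omega>] avg_bd[of "Suc j ^ 3" \<omega>] by linarith
  have D_exp: "expectation (\<lambda>\<omega>. (real (Suc j))\<^sup>2 * (D j \<omega>)\<^sup>2) \<le> 3 * inverse ((real (Suc j))\<^sup>2)" for j
  proof -
    define x where "x = real (Suc j)"
    have x: "x \<ge> 1" by (simp add: x_def)
    have "expectation (\<lambda>\<omega>. (D j \<omega>)\<^sup>2) = (p1 - p2) * (1 / real (Suc j ^ 3) - 1 / real (Suc (Suc j) ^ 3))"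
      unfolding D_def S_def by (rule expectation_average_diff_square[OF E p1 p2]) (auto intro!: power_mono)
    also have "\<dots> \<le> 1 * (1 / real (Suc j ^ 3) - 1 / real (Suc (Suc j) ^ 3))"
      using \<open>p1 - p2 \<le> 1\<close> by (intro mult_right_mono) (auto simp: frac_le power_mono)
    also have "\<dots> = 1 / x ^ 3 - 1 / (x + 1) ^ 3" by (simp add: x_def add.commute)
    \<comment> \<open>The bound that the mean value theorem gives for \<open>1 / x ^ 3\<close>,
      obtained here by clearing denominators.\<close>
    also have "\<dots> \<le> 3 / x ^ 4"
    proof -
      have "(x + 1) ^ 3 - x ^ 3 = 3 * x\<^sup>2 + 3 * x + 1" by algebra
      also have "x * \<dots> \<le> 3 * (x + 1) ^ 3"
      proof -
        have "3 * (x + 1) ^ 3 - x * (3 * x\<^sup>2 + 3 * x + 1) = 6 * x\<^sup>2 + 8 * x + 3" by algebra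
        with x show ?thesis by (smt (verit) zero_le_power2)
      qed
      finally have "x * ((x + 1) ^ 3 - x ^ 3) \<le> 3 * (x + 1) ^ 3" .
      then have "x * ((x + 1) ^ 3 - x ^ 3) / (x ^ 4 * (x + 1) ^ 3) \<le> 3 * (x + 1) ^ 3 / (x ^ 4 * (x + 1) ^ 3)"
        using x by (intro divide_right_mono) auto
      moreover have "x * ((x + 1) ^ 3 - x ^ 3) / (x ^ 4 * (x + 1) ^ 3) = 1 / x ^ 3 - 1 / (x + 1) ^ 3"
        using x by (simp add: divide_simps) algebra
      moreover have "3 * (x + 1) ^ 3 / (x ^ 4 * (x + 1) ^ 3) = 3 / x ^ 4" using x by simp
      ultimately show ?thesis by simp
    qed
    finally have "x\<^sup>2 * expectation (\<lambda>\<omega>. (D j \<omega>)\<^sup>2) \<le> x\<^sup>2 * (3 / x ^ 4)"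
      by (intro mult_left_mono) auto
    also have "\<dots> = 3 * inverse (x\<^sup>2)" using x by (simp add: field_simps power2_eq_square power4_eq_xxxx)
    finally show ?thesis by (simp add: x_def)
  qed
  have summ: "summable (\<lambda>j. inverse ((real (Suc j))\<^sup>2))"
    using sums_summable[OF inverse_squares_sums] by (simp add: inverse_eq_divide add.commute)
  have "(\<integral>\<^sup>+\<omega>. (\<Sum>j. ennreal ((real (Suc j))\<^sup>2 * (D j \<omega>)\<^sup>2)) \<partial>M) =
      (\<Sum>j. \<integral>\<^sup>+\<omega>. ennreal ((real (Suc j))\<^sup>2 * (D j \<omega>)\<^sup>2) \<partial>M)"
    by (rule nn_integral_suminf) measurable
  also have "\<dots> = (\<Sum>j. ennreal (expectation (\<lambda>\<omega>. (real (Suc j))\<^sup>2 * (D j \<omega>)\<^sup>2)))"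
  proof (intro suminf_cong nn_integral_eq_integral)
    fix j
    show "integrable M (\<lambda>\<omega>. (real (Suc j))\<^sup>2 * (D j \<omega>)\<^sup>2)"
      using D_bd by (intro integrable_mult_right integrable_const_bound[of _ 1]) (auto simp: abs_square_le_1)
  qed auto
  also have "\<dots> \<le> (\<Sum>j. ennreal (3 * inverse ((real (Suc j))\<^sup>2)))"
    by (intro suminf_le ennreal_leI D_exp) auto
  also have "\<dots> < \<infinity>"
    using summ by (subst suminf_ennreal2) (auto intro: summable_mult)
  finally have fin: "(\<integral>\<^sup>+\<omega>. (\<Sum>j. ennreal ((real (Suc j))\<^sup>2 * (D j \<omega>)\<^sup>2)) \<partial>M) \<noteq> \<infinity>" by simp
  have "AE \<omega> in M. (\<Sum>j. ennreal ((real (Suc j))\<^sup>2 * (D j \<omega>)\<^sup>2)) \<noteq> \<infinity>"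
    by (rule nn_integral_noteq_infinite[OF _ fin]) measurable
  then show ?thesis
  proof eventually_elim
    case (elim \<omega>)
    have "summable (\<lambda>j. (real (Suc j))\<^sup>2 * (D j \<omega>)\<^sup>2)"
      using elim by (intro summable_suminf_not_top) auto
    then have "summable (\<lambda>j. (real (Suc j))\<^sup>2 * (D j \<omega>)\<^sup>2 + inverse ((real (Suc j))\<^sup>2))"
      using summ by (rule summable_add)
    \<comment> \<open>The square of a difference being nonnegative passes from squares to absolute
      values; the weight \<open>x ^ 2\<close> makes both terms on the right summable.\<close>
    moreover have "norm (D j \<omega>) \<le> (real (Suc j))\<^sup>2 * (D j \<omega>)\<^sup>2 + inverse ((real (Suc j))\<^sup>2)" for j
    proof -
      define x where "x = real (Suc j)"
      have x: "x > 0" by (simp add: x_def)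
      have "0 \<le> (x * \<bar>D j \<omega>\<bar> - inverse x)\<^sup>2" by simp
      also have "\<dots> = x\<^sup>2 * (D j \<omega>)\<^sup>2 + inverse (x\<^sup>2) - 2 * \<bar>D j \<omega>\<bar>"
        using x by (simp add: power2_diff power_mult_distrib power_inverse)
      finally show ?thesis unfolding x_def[symmetric] by simp
    qed
    ultimately have "summable (\<lambda>j. D j \<omega>)"
      by (intro summable_comparison_test'[of _ 0 "\<lambda>j. D j \<omega>"]) auto
    define T where "T j = S (Suc j ^ 3) \<omega> / real (Suc j ^ 3)" for j
    have "(\<Sum>j<n. D j \<omega>) = T n - T 0" for n
      unfolding D_def T_def[symmetric] by (rule sum_lessThan_telescope)
    then have "(\<lambda>n. T n - T 0) \<longlonglongrightarrow> suminf (\<lambda>j. D j \<omega>)"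
      using summable_LIMSEQ[OF \<open>summable (\<lambda>j. D j \<omega>)\<close>] by simp
    from tendsto_add[OF this tendsto_const[of "T 0"]] obtain c where "T \<longlonglongrightarrow> c" by auto
    then have "(\<lambda>j. S (j ^ 3) \<omega> / real (j ^ 3)) \<longlonglongrightarrow> c"
      unfolding T_def by (rule LIMSEQ_imp_Suc)
    moreover have "mono (\<lambda>m. S m \<omega>)"
      unfolding S_def by (intro monoI sum_mono2) auto
    ultimately have "(\<lambda>m. S m \<omega> / real m) \<longlonglongrightarrow> c"
      using S_bd by (intro averages_tendsto_of_cubes) auto
    then show ?case unfolding S_def by (rule convergentI)
  qed
qed

text \<open>Averaging the indicators of \<open>F A\<close> over all \<open>A\<close> of size
  \<open>r\<close> below \<open>m\<close> gives exactly \<open>h m\<close>, so \<open>h m\<close>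
  has mean \<open>p r\<close> once \<open>r \<le> m\<close>. As \<open>h m\<close> is bounded by 1
  and tends to \<open>C ^ r\<close>, dominated convergence passes to the limit.\<close>

lemma limit_average_moments:
  assumes E: "\<And>i. E i \<in> events"
    and p: "\<And>A. finite A \<Longrightarrow> prob {\<omega> \<in> space M. \<forall>i\<in>A. \<omega> \<in> E i} = p (card A)"
    and lim: "AE \<omega> in M. (\<lambda>m. (\<Sum>i<m. indicator (E i) \<omega> :: real) / real m) \<longlonglongrightarrow> C \<omega>"
    and C: "C \<in> borel_measurable M"
  shows "expectation (\<lambda>\<omega>. C \<omega> ^ r) = p r"
proof -
  define N where "N m \<omega> = card {i. i < m \<and> \<omega> \<in> E i}" for m \<omega>
  have N_sum: "(\<Sum>i<m. indicator (E i) \<omega> :: real) = real (N m \<omega>)" for m \<omega>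
    by (simp add: N_def indicator_def sum.If_cases Int_def)
  have N_le: "N m \<omega> \<le> m" for m \<omega>
    unfolding N_def using card_mono[of "{..<m}" "{i. i < m \<and> \<omega> \<in> E i}"] by auto
  define h where "h m \<omega> = real (N m \<omega> choose r) / real (m choose r)" for m \<omega>
  have ev: "{\<omega> \<in> space M. \<forall>i\<in>A. \<omega> \<in> E i} \<in> events" if "finite A" for A
    using that E by (intro sets.sets_Collect_finite_All) (auto intro: sets.Int simp: Collect_conj_eq)
  define F where "F A = {\<omega> \<in> space M. \<forall>i\<in>A. \<omega> \<in> E i}" for A
  \<comment> \<open>Both sides count the \<open>r\<close>-subsets of the indices below
    \<open>m\<close> whose events all occur.\<close>
  have N_choose: "real (N m \<omega> choose r) = (\<Sum>A | A \<subseteq> {..<m} \<and> card A = r. indicator (F A) \<omega>)"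
    if "\<omega> \<in> space M" for m \<omega>
  proof -
    have "(\<Sum>A | A \<subseteq> {..<m} \<and> card A = r. indicator (F A) \<omega> :: real) =
        real (card ({A. A \<subseteq> {..<m} \<and> card A = r} \<inter> {A. \<omega> \<in> F A}))"
      by (simp add: indicator_def sum.If_cases)
    also have "{A. A \<subseteq> {..<m} \<and> card A = r} \<inter> {A. \<omega> \<in> F A} = {A. A \<subseteq> {i. i < m \<and> \<omega> \<in> E i} \<and> card A = r}"
      using that by (auto simp: F_def)
    also have "card \<dots> = N m \<omega> choose r" unfolding N_def by (rule n_subsets) simp
    finally show ?thesis by simp
  qed
  have h_meas: "h m \<in> borel_measurable M" for m
  proof -
    have "(\<lambda>\<omega>. (\<Sum>A | A \<subseteq> {..<m} \<and> card A = r. indicator (F A) \<omega>) / real (m choose r)) \<in> borel_measurable M"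
      using ev by (intro borel_measurable_divide borel_measurable_sum borel_measurable_indicator)
        (auto simp: F_def intro: finite_subset)
    then show ?thesis by (rule measurable_cong[THEN iffD2, rotated]) (simp add: h_def N_choose)
  qed
  have h_exp: "expectation (h m) = p r" if "r \<le> m" for m
  proof -
    have "expectation (h m) = expectation (\<lambda>\<omega>. (\<Sum>A | A \<subseteq> {..<m} \<and> card A = r. indicator (F A) \<omega>) / real (m choose r))"
      by (intro Bochner_Integration.integral_cong) (simp_all add: h_def N_choose)
    also have "\<dots> = (\<Sum>A | A \<subseteq> {..<m} \<and> card A = r. prob (F A)) / real (m choose r)"
    proof -
      have "F A \<in> events" if "A \<subseteq> {..<m}" for A
        using that ev[of A] by (auto simp: F_def intro: finite_subset)
      then show ?thesis by (simp add: Bochner_Integration.integral_sum less_top[symmetric])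
    qed
    also have "(\<Sum>A | A \<subseteq> {..<m} \<and> card A = r. prob (F A)) = (\<Sum>A | A \<subseteq> {..<m} \<and> card A = r. p r)"
      using p by (intro sum.cong) (auto simp: F_def intro: finite_subset)
    also have "\<dots> = real (m choose r) * p r" using n_subsets[of "{..<m}" r] by simp
    finally show ?thesis using that by simp
  qed
  have h_bd: "\<bar>h m \<omega>\<bar> \<le> 1" for m \<omega>
    using binomial_right_mono[OF N_le[of m \<omega>], of r] by (auto simp: h_def divide_simps)
  have h_lim: "AE \<omega> in M. (\<lambda>m. h m \<omega>) \<longlonglongrightarrow> C \<omega> ^ r"
    using lim
  proof eventually_elim
    case (elim \<omega>)
    \<comment> \<open>With \<open>fact r\<close> cancelled, the quotient of binomials is a product
      of factors \<open>(N m - i) / (m - i)\<close>; dividing above and below by \<open>m\<close>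
      exhibits the limit \<open>C\<close> of each.\<close>
    have "(\<lambda>m. \<Prod>i<r. (real (N m \<omega>) / real m - real i / real m) / (1 - real i / real m)) \<longlonglongrightarrow> (\<Prod>i<r. (C \<omega> - 0) / (1 - 0))"
    proof (intro tendsto_prod tendsto_divide tendsto_diff tendsto_const)
      show "(\<lambda>m. real (N m \<omega>) / real m) \<longlonglongrightarrow> C \<omega>" using elim by (simp add: N_sum)
    qed (use lim_const_over_n in auto)
    moreover have "eventually (\<lambda>m. (\<Prod>i<r. (real (N m \<omega>) / real m - real i / real m) / (1 - real i / real m)) = h m \<omega>) sequentially"
      \<comment> \<open>\<open>m > r\<close> keeps \<open>m\<close> and all \<open>m - i\<close>
        with \<open>i < r\<close> nonzero.\<close>
      using eventually_ge_at_top[of "Suc r"]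
    proof eventually_elim
      case (elim m)
      have "(real (N m \<omega>) / real m - real i / real m) / (1 - real i / real m) = (real (N m \<omega>) - real i) / (real m - real i)"
        if "i < r" for i
        using elim that by (simp add: divide_simps)
      then have "(\<Prod>i<r. (real (N m \<omega>) / real m - real i / real m) / (1 - real i / real m)) =
          (\<Prod>i<r. real (N m \<omega>) - real i) / (\<Prod>i<r. real m - real i)"
        by (simp add: prod_dividef)
      also have "\<dots> = h m \<omega>"
        by (simp add: h_def binomial_gbinomial gbinomial_prod_rev atLeast0LessThan)
      finally show ?case .
    qed
    ultimately show ?case using Lim_transform_eventually by fastforce
  qed
  have "(\<lambda>m. expectation (h m)) \<longlonglongrightarrow> expectation (\<lambda>\<omega>. C \<omega> ^ r)"
    by (rule integral_dominated_convergence[where w = "\<lambda>_. 1"])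
      (use C h_meas h_lim h_bd in auto)
  moreover have "(\<lambda>m. expectation (h m)) \<longlonglongrightarrow> p r"
    by (intro tendsto_eventually eventually_mono[OF eventually_ge_at_top[of r] h_exp])
  ultimately show ?thesis by (rule LIMSEQ_unique)
qed

end

subsection \<open>Beta distributions and their moments\<close>

text \<open>Absolute moments of a law on [-1, 1] are at most 1, so the Taylor remainder of its
  characteristic function is at most \<open>2 * \<bar>t\<bar> ^ n / fact n\<close> and vanishes. The
  moments thus determine the characteristic function, hence the law.\<close>

lemma real_distribution_eq_of_moments:
  assumes "real_distribution \<mu>" "real_distribution \<nu>"
    and bnd: "AE x in \<mu>. \<bar>x\<bar> \<le> 1" "AE x in \<nu>. \<bar>x\<bar> \<le> 1"
    and mom: "\<And>r. integral\<^sup>L \<mu> (\<lambda>x. x ^ r) = integral\<^sup>L \<nu> (\<lambda>x. x ^ r)"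
  shows "\<mu> = \<nu>"
proof (rule Levy_uniqueness[OF assms(1,2)], rule ext)
  fix t :: real
  have conv: "(\<lambda>n. \<Sum>k\<le>n. ((\<i> * t) ^ k / fact k) * integral\<^sup>L \<kappa> (\<lambda>x. x ^ k)) \<longlonglongrightarrow> char \<kappa> t"
    if "real_distribution \<kappa>" and b: "AE x in \<kappa>. \<bar>x\<bar> \<le> 1" for \<kappa> :: "real measure"
  proof -
    interpret real_distribution \<kappa> by fact
    have int: "integrable \<kappa> (\<lambda>x. x ^ k)" for k
      by (rule integrable_const_bound[of _ 1])
        (use b in \<open>auto simp: power_abs intro: power_le_one elim!: eventually_mono\<close>)
    have le: "cmod ((\<Sum>k\<le>n. ((\<i> * t) ^ k / fact k) * expectation (\<lambda>x. x ^ k)) - char \<kappa> t)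
        \<le> 2 * (\<bar>t\<bar> ^ n / fact n)" for n
    proof -
      have "expectation (\<lambda>x. \<bar>x\<bar> ^ n) \<le> expectation (\<lambda>x. 1)"
        using integrable_abs[OF int[of n]] b
        by (intro integral_mono_AE) (auto simp: power_abs intro: power_le_one elim!: eventually_mono)
      then have "expectation (\<lambda>x. \<bar>x\<bar> ^ n) \<le> 1" using prob_space by simp
      then have "(2 * \<bar>t\<bar> ^ n / fact n) * expectation (\<lambda>x. \<bar>x\<bar> ^ n) \<le> (2 * \<bar>t\<bar> ^ n / fact n) * 1"
        by (intro mult_left_mono) auto
      with char_approx1[of n t, OF int] show ?thesis
        by (simp add: norm_minus_commute)
    qed
    have "(\<lambda>n. \<bar>t\<bar> ^ n / fact n) \<longlonglongrightarrow> 0"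
      using summable_LIMSEQ_zero[OF summable_exp[of "\<bar>t\<bar>"]] by (simp add: divide_inverse mult.commute)
    from tendsto_mult_right_zero[OF this, of 2]
    have lim: "(\<lambda>n. 2 * (\<bar>t\<bar> ^ n / fact n)) \<longlonglongrightarrow> 0" .
    show ?thesis
      by (rule LIM_zero_cancel, rule Lim_null_comparison[OF always_eventually lim], rule allI, rule le)
  qed
  show "char \<mu> t = char \<nu> t"
    using LIMSEQ_unique[OF conv[OF assms(1) bnd(1)]] conv[OF assms(2) bnd(2)] mom by simp
qed

section \<open>The Beta law: total mass, support and moments\<close>

lemma beta_density_nonneg: "0 < a \<Longrightarrow> 0 < b \<Longrightarrow> 0 \<le> beta_density a b x"
  by (simp add: beta_density_def Beta_def Gamma_real_pos less_imp_le)

lemma beta_density_measurable[measurable]: "beta_density a b \<in> borel_measurable borel"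
  unfolding beta_density_def by measurable

text \<open>The factor \<open>x ^ r\<close> raises the first parameter from \<open>a\<close> to
  \<open>a + r\<close>, which leaves a Beta integral over the old normalising constant. The case
  \<open>r = 0\<close> is the total mass, the others are the moments.\<close>

lemma nn_integral_beta_density_power:
  assumes "0 < a" "0 < b"
  shows "(\<integral>\<^sup>+x. ennreal (beta_density a b x * x ^ r) \<partial>lborel) = ennreal (Beta (a + real r) b / Beta a b)"
proof (rule nn_integral_has_integral_lborel)
  have "((\<lambda>x. x powr (a + real r - 1) * (1 - x) powr (b - 1) / Beta a b) has_integral
      (Beta (a + real r) b / Beta a b)) {0<..<1}"
    using has_integral_Beta_real[of "a + real r" b] assms
    by (intro has_integral_divide) (simp add: has_integral_Icc_iff_Ioo)
  moreover have "x powr (a + real r - 1) * (1 - x) powr (b - 1) / Beta a b = beta_density a b x * x ^ r"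
    if "x \<in> {0<..<1}" for x
  proof -
    have "x powr (a + real r - 1) = x powr (a - 1) * x ^ r"
      using that by (simp add: powr_realpow[symmetric] powr_add[symmetric] algebra_simps)
    then show ?thesis using that by (simp add: beta_density_def)
  qed
  ultimately have "((\<lambda>x. beta_density a b x * x ^ r) has_integral
      (Beta (a + real r) b / Beta a b)) {0<..<1}"
    using has_integral_cong by (metis (no_types, lifting))
  then show "((\<lambda>x. beta_density a b x * x ^ r) has_integral (Beta (a + real r) b / Beta a b)) UNIV"
    by (rule has_integral_on_superset) (auto simp: beta_density_def)
  \<comment> \<open>Odd powers of negative \<open>x\<close> do no harm, as the density vanishes off
    the unit interval.\<close>
  show "0 \<le> beta_density a b x * x ^ r" for x
    using beta_density_nonneg[OF assms, of x] by (cases "0 < x") (auto simp: beta_density_def)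
qed simp

definition beta_distribution :: "real \<Rightarrow> real \<Rightarrow> real measure" where
  "beta_distribution a b = density lborel (\<lambda>x. ennreal (beta_density a b x))"

lemma Beta_real_pos: "0 < a \<Longrightarrow> 0 < b \<Longrightarrow> 0 < Beta a (b :: real)"
  by (simp add: Beta_def Gamma_real_pos)

lemma real_distribution_beta:
  assumes "0 < a" "0 < b"
  shows "real_distribution (beta_distribution a b)"
proof -
  have "emeasure (beta_distribution a b) (space (beta_distribution a b)) = 1"
    using nn_integral_beta_density_power[OF assms, of 0] Beta_real_pos[OF assms]
    by (simp add: beta_distribution_def emeasure_density)
  then interpret prob_space "beta_distribution a b" by (rule prob_spaceI)
  show ?thesis by unfold_locales (simp_all add: beta_distribution_def)
qed

lemma AE_beta_distribution: "AE x in beta_distribution a b. 0 < x \<and> x < 1"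
proof -
  have "AE x in lborel. 0 < ennreal (beta_density a b x) \<longrightarrow> 0 < x \<and> x < 1"
    by (rule AE_I2) (simp add: beta_density_def)
  then show ?thesis unfolding beta_distribution_def by (subst AE_density) simp_all
qed

lemma beta_distribution_moment:
  assumes "0 < a" "0 < b"
  shows "integral\<^sup>L (beta_distribution a b) (\<lambda>x. x ^ r) = Beta (a + real r) b / Beta a b"
proof -
  have "integral\<^sup>L (beta_distribution a b) (\<lambda>x. x ^ r) = (\<integral>x. beta_density a b x * x ^ r \<partial>lborel)"
    unfolding beta_distribution_def using beta_density_nonneg[OF assms]
    by (subst integral_density) auto
  also have "\<dots> = Beta (a + real r) b / Beta a b"
    using nn_integral_beta_density_power[OF assms, of r] Beta_real_pos[of "a + real r" b] Beta_real_pos[OF assms] assms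
      beta_density_nonneg[OF assms]
    by (intro integral_eq_nn_integral[THEN trans]) (auto simp: beta_density_def intro!: AE_I2)
  finally show ?thesis .
qed

text \<open>With integer parameters the Gamma values are factorials and \<open>Gamma b\<close>
  cancels. This identity matches the Beta moments with the probabilities found by counting.\<close>

lemma Beta_quotient_binomial:
  assumes "1 \<le> b" "b \<le> n"
  shows "Beta (real (n + 1 - b) + real r) (real b) / Beta (real (n + 1 - b)) (real b) =
    real (n choose b) / real ((n + r) choose b)"
proof -
  have G: "Gamma (real (Suc m)) = fact m" for m using Gamma_fact[of m, where 'a = real] by (simp add: add.commute)
  have 1: "n + 1 - b = Suc (n - b)" using assms by simp
  have 2: "real (n + 1 - b) + real r = real (Suc (n + r - b))" "real (n + 1 - b) + real r + real b = real (Suc (n + r))"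
    "real (n + 1 - b) + real b = real (Suc n)"
    using assms by auto
  show ?thesis
    unfolding Beta_def 2 1 using 2 Gamma_real_pos[of "real b"] assms
    by (simp only: G 1) (simp add: binomial_fact G less_imp_neq[symmetric] divide_simps del: of_nat_Suc)
qed

subsection \<open>The largest elements of an exchangeable family\<close>

text \<open>The \<open>card B\<close> largest elements, without a tie across the boundary of
  \<open>B\<close>. The strict inequality makes sets of equal size unique; existence for a
  prescribed size relies on injectivity of \<open>f\<close>.\<close>

definition top_set :: "('i \<Rightarrow> real) \<Rightarrow> 'i set \<Rightarrow> 'i set \<Rightarrow> bool" where
  "top_set f I B \<longleftrightarrow> B \<subseteq> I \<and> (\<forall>x\<in>B. \<forall>y\<in>I - B. f y < f x)"

text \<open>The entries below \<open>y\<close> form an initial segment of a sorted list, and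
  position \<open>k\<close> lies beyond it exactly when its length is at most \<open>k\<close>. This
  turns comparison with an order statistic into a count.\<close>

lemma sorted_nth_ge_iff:
  fixes xs :: "'a::linorder list"
  assumes "sorted xs" "k < length xs"
  shows "y \<le> xs ! k \<longleftrightarrow> length (filter (\<lambda>x. x < y) xs) \<le> k"
  using assms
proof (induction xs arbitrary: k)
  case (Cons a xs)
  show ?case
  proof (cases "a < y")
    case True
    with Cons show ?thesis by (cases k) auto
  next
    case False
    then have "y \<le> z" if "z \<in> set (a # xs)" for z
      using that Cons.prems(1) by fastforce
    moreover have "filter (\<lambda>x. x < y) (a # xs) = []"
      using calculation by (auto simp: filter_empty_conv not_less)
    ultimately show ?thesis
      using Cons.prems(2) nth_mem[of k "a # xs"] by auto
  qed
qed simp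

lemma sort_nth_ge_iff:
  fixes xs :: "'a::linorder list"
  assumes "k < length xs"
  shows "y \<le> sort xs ! k \<longleftrightarrow> length (filter (\<lambda>x. x < y) xs) \<le> k"
  using sorted_nth_ge_iff[of "sort xs" k y] assms
  by (simp add: filter_sort)

text \<open>Greedy construction: adjoin the index of the maximum of the remaining values.
  Injectivity makes that maximum strict.\<close>

lemma top_set_exists:
  assumes "finite I" "inj_on f I" "b \<le> card I"
  shows "\<exists>B. card B = b \<and> top_set f I B"
  using assms(3)
proof (induction b)
  case 0
  show ?case by (rule exI[of _ "{}"]) (simp add: top_set_def)
next
  case (Suc b)
  then obtain B where B: "card B = b" "top_set f I B" by auto
  have finB: "finite B" using B(2) assms(1) by (auto simp: top_set_def intro: finite_subset)
  have ne: "I - B \<noteq> {}"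
  proof
    assume "I - B = {}"
    then have "card I \<le> card B" using finB by (intro card_mono) auto
    then show False using Suc.prems B(1) by simp
  qed
  have fin: "finite (f ` (I - B))" using assms(1) by simp
  have "Max (f ` (I - B)) \<in> f ` (I - B)" using ne by (intro Max_in[OF fin]) simp
  then obtain m where m: "m \<in> I - B" "f m = Max (f ` (I - B))" by (metis imageE)
  then have max: "f y \<le> f m" if "y \<in> I - B" for y
    using fin that by simp
  have "f y < f m" if "y \<in> I - insert m B" for y
  proof -
    have "f y \<noteq> f m" using that m(1) assms(2) by (auto dest: inj_onD)
    with max[of y] that show ?thesis by auto
  qed
  then have "top_set f I (insert m B)"
    using B(2) m(1) by (auto simp: top_set_def)
  moreover have "card (insert m B) = Suc b" using finB m(1) B(1) by simp
  ultimately show ?case by blast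
qed

text \<open>Different finite sets of equal size each contain an index outside the other, and each of
  the two values would have to exceed the other.\<close>

lemma top_set_unique:
  assumes "finite I" "top_set f I B" "top_set f I B'" "card B = card B'"
  shows "B = B'"
proof (rule ccontr)
  assume ne: "B \<noteq> B'"
  have fin: "finite B" "finite B'" using assms(1-3) by (auto simp: top_set_def intro: finite_subset)
  have "\<not> B \<subseteq> B'" "\<not> B' \<subseteq> B"
    using ne fin assms(4) card_subset_eq[of B' B] card_subset_eq[of B B'] by auto
  then obtain x y where "x \<in> B - B'" "y \<in> B' - B" by blast
  then have "f y < f x" "f x < f y" using assms(2,3) by (auto simp: top_set_def)
  then show False by simp
qed

lemma disjoint_family_top_set:
  assumes "finite I"
  shows "disjoint_family_on (\<lambda>B. {\<omega> \<in> \<Omega>. top_set (f \<omega>) I B}) {B. Q B \<and> card B = b}"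
proof -
  have False if "top_set (f \<omega>) I B" "top_set (f \<omega>) I B'" "card B = b" "card B' = b" "B \<noteq> B'" for B B' \<omega>
    using top_set_unique[OF assms that(1,2)] that by simp
  then show ?thesis unfolding disjoint_family_on_def by blast
qed

lemma top_set_comp_permutes:
  assumes "\<pi> permutes I" "B \<subseteq> I"
  shows "top_set (f \<circ> \<pi>) I B \<longleftrightarrow> top_set f I (\<pi> ` B)"
proof -
  have "I - \<pi> ` B = \<pi> ` (I - B)"
    using assms permutes_image[OF assms(1)] permutes_inj[OF assms(1)]
    by (metis image_set_diff)
  moreover have "\<pi> ` B \<subseteq> I" using assms permutes_image[OF assms(1)] by blast
  ultimately show ?thesis using assms(2) by (auto simp: top_set_def)
qed

text \<open>Glue a bijection from \<open>B\<close> to \<open>B'\<close> with one between the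
  complements.\<close>

lemma permutes_image_subset_exists:
  assumes "finite I" "B \<subseteq> I" "B' \<subseteq> I" "card B = card B'"
  shows "\<exists>\<pi>. \<pi> permutes I \<and> \<pi> ` B = B'"
proof -
  have fin: "finite B" "finite B'" using assms by (auto intro: finite_subset)
  obtain f where f: "bij_betw f B B'"
    using finite_same_card_bij[OF fin assms(4)] by blast
  have "card (I - B) = card (I - B')"
    using assms fin by (simp add: card_Diff_subset)
  then obtain g where g: "bij_betw g (I - B) (I - B')"
    using finite_same_card_bij[of "I - B" "I - B'"] assms(1) by blast
  define \<pi> where "\<pi> = (\<lambda>x. if x \<in> B then f x else if x \<in> I then g x else x)"
  have 1: "bij_betw \<pi> B B'" using f by (rule bij_betw_cong[THEN iffD1, rotated]) (simp add: \<pi>_def)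
  have 2: "bij_betw \<pi> (I - B) (I - B')"
    using g by (rule bij_betw_cong[THEN iffD1, rotated]) (simp add: \<pi>_def)
  have "bij_betw \<pi> (B \<union> (I - B)) (B' \<union> (I - B'))"
    by (rule bij_betw_combine[OF 1 2]) auto
  then have "bij_betw \<pi> I I" using assms(2,3) by (simp add: Un_absorb1)
  then have "\<pi> permutes I"
    by (rule bij_imp_permutes) (use assms(2) in \<open>auto simp: \<pi>_def\<close>)
  with 1 show ?thesis by (auto simp: bij_betw_def)
qed

text \<open>Think of \<open>K\<close> as the calibration indices and of \<open>J\<close> as the
  future ones. A future index in \<open>B\<close> leaves at most \<open>b - 1\<close> places of
  \<open>B\<close> to \<open>K\<close>, so at least \<open>card K + 1 - b\<close> calibration values
  lie below its own. If \<open>B\<close> lies in \<open>K\<close>, the calibration values below a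
  future one all come from \<open>K - B\<close>, which has \<open>card K - b\<close>
  elements.\<close>

lemma card_lower_lt_iff_top_subset:
  fixes f :: "'i \<Rightarrow> real"
  assumes I: "finite K" "finite J" "K \<inter> J = {}"
    and top: "top_set f (K \<union> J) B" "card B = b" and b: "1 \<le> b" "b \<le> card K"
  shows "(\<forall>i\<in>J. card {j\<in>K. f j < f i} < card K + 1 - b) \<longleftrightarrow> B \<subseteq> K"
proof
  assume L: "\<forall>i\<in>J. card {j\<in>K. f j < f i} < card K + 1 - b"
  show "B \<subseteq> K"
  proof (rule ccontr)
    assume "\<not> B \<subseteq> K"
    then obtain i where i: "i \<in> B" "i \<in> J" using top(1) by (auto simp: top_set_def)
    have finB: "finite B" using top(1) I by (auto simp: top_set_def intro: finite_subset)
    have "card (B \<inter> K) \<le> card (B - {i})"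
      using i I(3) finB by (intro card_mono) auto
    also have "\<dots> = b - 1" using i(1) top(2) finB by simp
    finally have "card K - card (B \<inter> K) \<ge> card K + 1 - b" using b by linarith
    moreover have "card (K - B) = card K - card (B \<inter> K)"
      using finB by (metis Int_commute card_Diff_subset_Int finite_Int)
    moreover have "card (K - B) \<le> card {j\<in>K. f j < f i}"
      using i(1) top(1) I(1) by (intro card_mono) (auto simp: top_set_def)
    ultimately show False using L i(2) by force
  qed
next
  assume R: "B \<subseteq> K"
  show "\<forall>i\<in>J. card {j\<in>K. f j < f i} < card K + 1 - b"
  proof
    fix i assume i: "i \<in> J"
    have finB: "finite B" using R I finite_subset by blast
    have "j \<notin> B" if "f j < f i" for j
    proof
      assume "j \<in> B"
      moreover have "i \<in> K \<union> J - B" using i R I(3) by auto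
      ultimately have "f i < f j" using top(1) by (auto simp: top_set_def)
      with that show False by simp
    qed
    then have "{j\<in>K. f j < f i} \<subseteq> K - B" by blast
    then have "card {j\<in>K. f j < f i} \<le> card (K - B)" using I(1) by (intro card_mono) auto
    also have "\<dots> = card K - b" using finB R top(2) by (simp add: card_Diff_subset)
    finally show "card {j\<in>K. f j < f i} < card K + 1 - b" using b by linarith
  qed
qed

section \<open>Uniform distribution of the top set\<close>

lemma top_set_measurable:
  fixes V :: "'i \<Rightarrow> 'w \<Rightarrow> real"
  assumes "\<And>i. i \<in> I \<Longrightarrow> V i \<in> borel_measurable M" "finite I"
  shows "{\<omega> \<in> space M. top_set (\<lambda>i. V i \<omega>) I B} \<in> sets M"
proof (cases "B \<subseteq> I")
  case True
  then have fin: "finite B" using assms(2) finite_subset by blast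
  have "{\<omega> \<in> space M. \<forall>x\<in>B. \<forall>y\<in>I - B. V y \<omega> < V x \<omega>} \<in> sets M"
    using True assms fin
    by (intro sets.sets_Collect_finite_All' sets.sets_Collect_finite_All borel_measurable_less) auto
  then show ?thesis using True by (simp add: top_set_def)
next
  case False
  then show ?thesis by (simp add: top_set_def)
qed

text \<open>A permutation of \<open>I\<close> carrying \<open>B\<close> to \<open>B'\<close> also
  permutes an initial segment containing \<open>I\<close>, where exchangeability applies;
  relabelling the values turns the event for \<open>B\<close> into that for
  \<open>B'\<close>.\<close>

lemma prob_top_set_eq:
  fixes V :: "nat \<Rightarrow> 'w \<Rightarrow> real"
  assumes ex: "exchangeable M borel V" and I: "finite I"
    and B: "B \<subseteq> I" "B' \<subseteq> I" "card B = card B'"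
  shows "measure M {\<omega> \<in> space M. top_set (\<lambda>i. V i \<omega>) I B} =
         measure M {\<omega> \<in> space M. top_set (\<lambda>i. V i \<omega>) I B'}"
proof -
  have V[measurable]: "V j \<in> borel_measurable M" for j using ex by (simp add: exchangeable_def)
  obtain N where "\<forall>i\<in>I. i \<le> N" using I finite_nat_set_iff_bounded_le by blast
  then have N: "I \<subseteq> {..<Suc N}" by auto
  let ?N = "{..<Suc N}"
  obtain \<pi> where \<pi>: "\<pi> permutes I" "\<pi> ` B = B'"
    using permutes_image_subset_exists[OF I B] by blast
  have \<pi>N: "\<pi> permutes ?N" using \<pi>(1) N by (rule permutes_subset)
  let ?P = "PiM ?N (\<lambda>_. borel :: real measure)"
  let ?Q = "{w \<in> space ?P. top_set w I B}"
  have Q: "?Q \<in> sets ?P"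
    by (rule top_set_measurable) (use N I in \<open>auto intro!: measurable_component_singleton\<close>)
  have eq: "distr M ?P (\<lambda>\<omega>. \<lambda>j\<in>?N. V (\<pi> j) \<omega>) = distr M ?P (\<lambda>\<omega>. \<lambda>j\<in>?N. V j \<omega>)"
    using ex \<pi>N by (simp add: exchangeable_def)
  \<comment> \<open>The event depends only on coordinates in \<open>I\<close>, so restriction to the
    initial segment does not change it.\<close>
  have top: "top_set (restrict f ?N) I B = top_set f I B" for f :: "nat \<Rightarrow> real"
    using N B(1) by (force simp: top_set_def)
  have *: "measure (distr M ?P (\<lambda>\<omega>. \<lambda>j\<in>?N. V (\<sigma> j) \<omega>)) ?Q =
      measure M {\<omega> \<in> space M. top_set (\<lambda>i. V (\<sigma> i) \<omega>) I B}" for \<sigma>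
    using Q by (subst measure_distr)
      (auto intro!: arg_cong[where f = "measure M"] simp: top space_PiM)
  have top: "top_set (\<lambda>i. V (\<pi> i) \<omega>) I B \<longleftrightarrow> top_set (\<lambda>i. V i \<omega>) I B'" for \<omega>
    using top_set_comp_permutes[OF \<pi>(1) B(1), of "\<lambda>i. V i \<omega>"] \<pi>(2) by (simp add: comp_def)
  have "measure M {\<omega> \<in> space M. top_set (\<lambda>i. V i \<omega>) I B} =
      measure M {\<omega> \<in> space M. top_set (\<lambda>i. V (\<pi> i) \<omega>) I B}"
    using *[of id] *[of \<pi>] eq by simp
  also have "\<dots> = measure M {\<omega> \<in> space M. top_set (\<lambda>i. V i \<omega>) I B'}"
    using top by simp
  finally show ?thesis .
qed

text \<open>Without ties exactly one subset of size \<open>card B\<close> is the top set. All are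
  equally likely, and the probabilities of these disjoint events sum to 1.\<close>

lemma (in prob_space) prob_top_set:
  fixes V :: "nat \<Rightarrow> 'a \<Rightarrow> real"
  assumes ex: "exchangeable M borel V" and I: "finite I"
    and noties: "AE \<omega> in M. inj (\<lambda>i. V i \<omega>)"
    and B: "B \<subseteq> I"
  shows "prob {\<omega> \<in> space M. top_set (\<lambda>i. V i \<omega>) I B} = 1 / real (card I choose card B)"
proof -
  have V: "V j \<in> borel_measurable M" for j using ex by (simp add: exchangeable_def)
  let ?E = "\<lambda>B. {\<omega> \<in> space M. top_set (\<lambda>i. V i \<omega>) I B}"
  let ?S = "{B'. B' \<subseteq> I \<and> card B' = card B}"
  have E: "?E B' \<in> events" for B' using top_set_measurable[OF V I] .
  have finS: "finite ?S" using I by auto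
  have bI: "card B \<le> card I" using I B by (rule card_mono)
  have "AE \<omega> in M. \<omega> \<in> (\<Union>B'\<in>?S. ?E B')"
    using noties AE_space
  proof eventually_elim
    case (elim \<omega>)
    from elim(1) have "inj_on (\<lambda>i. V i \<omega>) I" by (rule inj_on_subset) simp
    from top_set_exists[OF I this bI] show ?case
      using elim(2) by (auto simp: top_set_def)
  qed
  then have "prob (\<Union>B'\<in>?S. ?E B') = 1"
    by (rule prob_eq_1[OF sets.finite_UN[OF finS E], THEN iffD2])
  then have "1 = prob (\<Union>B'\<in>?S. ?E B')" by (rule sym)
  also have "\<dots> = (\<Sum>B'\<in>?S. prob (?E B'))"
    by (rule finite_measure_finite_Union[OF finS _ disjoint_family_top_set[OF I]]) (rule image_subsetI, rule E)
  also have "\<dots> = (\<Sum>B'\<in>?S. prob (?E B))"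
    by (rule sum.cong[OF refl], rule prob_top_set_eq[OF ex I]) (use B in simp_all)
  also have "\<dots> = real (card I choose card B) * prob (?E B)"
    using n_subsets[OF I] by simp
  finally show ?thesis using bI by (simp add: field_simps)
qed


lemma lower_count_measurable:
  fixes V :: "'i \<Rightarrow> 'w \<Rightarrow> real"
  assumes [measurable]: "\<And>j. V j \<in> borel_measurable M" and fin: "finite K"
  shows "{\<omega> \<in> space M. card {j\<in>K. V j \<omega> < V i \<omega>} < c} \<in> sets M"
proof -
  have "real (card {j\<in>K. V j \<omega> < V i \<omega>}) = (\<Sum>j\<in>K. if V j \<omega> < V i \<omega> then 1 else 0)" for \<omega>
    using fin by (simp add: sum.If_cases Int_def)
  moreover have "(\<lambda>\<omega>. \<Sum>j\<in>K. if V j \<omega> < V i \<omega> then 1 else 0 :: real) \<in> borel_measurable M"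
    by (intro borel_measurable_sum) measurable
  ultimately have "(\<lambda>\<omega>. real (card {j\<in>K. V j \<omega> < V i \<omega>})) \<in> borel_measurable M"
    by simp
  from borel_measurable_less[OF this borel_measurable_const[of "real c"]]
  show ?thesis by (simp only: of_nat_less_iff)
qed

text \<open>Almost surely the event says that the top set of size \<open>b\<close> lies inside
  \<open>K\<close>. It thus splits into \<open>card K choose b\<close> disjoint events of equal
  probability.\<close>

lemma (in prob_space) prob_covered:
  fixes V :: "nat \<Rightarrow> 'a \<Rightarrow> real"
  assumes ex: "exchangeable M borel V"
    and noties: "AE \<omega> in M. inj (\<lambda>i. V i \<omega>)"
    and fin: "finite K" "finite J" "K \<inter> J = {}" and b: "1 \<le> b" "b \<le> card K"
  shows "prob {\<omega> \<in> space M. \<forall>i\<in>J. card {j\<in>K. V j \<omega> < V i \<omega>} < card K + 1 - b} =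
    real (card K choose b) / real ((card K + card J) choose b)"
proof -
  have V[measurable]: "V j \<in> borel_measurable M" for j using ex by (simp add: exchangeable_def)
  let ?I = "K \<union> J"
  have I: "finite ?I" "card ?I = card K + card J" using fin by (auto simp: card_Un_disjoint)
  let ?E = "\<lambda>B. {\<omega> \<in> space M. top_set (\<lambda>i. V i \<omega>) ?I B}"
  let ?S = "{B. B \<subseteq> K \<and> card B = b}"
  let ?F = "{\<omega> \<in> space M. \<forall>i\<in>J. card {j\<in>K. V j \<omega> < V i \<omega>} < card K + 1 - b}"
  have E: "?E B' \<in> events" for B' using top_set_measurable[OF V I(1)] .
  have F: "?F \<in> events"
    by (rule sets.sets_Collect_finite_All[OF lower_count_measurable[OF V fin(1)] fin(2)])
  have finS: "finite ?S" using fin by auto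
  have "AE \<omega> in M. \<omega> \<in> ?F \<longleftrightarrow> \<omega> \<in> (\<Union>B\<in>?S. ?E B)"
    using noties AE_space
  proof eventually_elim
    case (elim \<omega>)
    have "inj_on (\<lambda>i. V i \<omega>) ?I" using elim(1) by (rule inj_on_subset) simp
    moreover have "b \<le> card ?I" using I(2) b(2) by simp
    ultimately obtain B where B: "card B = b" "top_set (\<lambda>i. V i \<omega>) ?I B"
      using top_set_exists[OF I(1)] by metis
    \<comment> \<open>\<open>B\<close> is the only top set of size \<open>b\<close> at
      \<open>\<omega>\<close>, so the union reduces to a condition on \<open>B\<close>.\<close>
    have "\<omega> \<in> (\<Union>B\<in>?S. ?E B) \<longleftrightarrow> B \<subseteq> K"
    proof
      assume "\<omega> \<in> (\<Union>B\<in>?S. ?E B)"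
      then obtain B' where "B' \<in> ?S" "\<omega> \<in> ?E B'" by (rule UN_E)
      then have B': "B' \<subseteq> K" "card B' = b" "top_set (\<lambda>i. V i \<omega>) ?I B'" by simp_all
      have "B = B'" using B B' by (intro top_set_unique[OF I(1) B(2)]) simp_all
      with B'(1) show "B \<subseteq> K" by simp
    next
      assume "B \<subseteq> K"
      with B(1) have "B \<in> ?S" by simp
      then show "\<omega> \<in> (\<Union>B\<in>?S. ?E B)" by (rule UN_I) (simp add: B(2) elim(2))
    qed
    also have "\<dots> \<longleftrightarrow> \<omega> \<in> ?F"
      using card_lower_lt_iff_top_subset[OF fin B(2,1) b] elim(2) by simp
    finally show ?case by (rule sym)
  qed
  then have "prob ?F = prob (\<Union>B\<in>?S. ?E B)"
    by (rule finite_measure_eq_AE[OF _ F sets.finite_UN[OF finS E]])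
  also have "\<dots> = (\<Sum>B\<in>?S. prob (?E B))"
    by (rule finite_measure_finite_Union[OF finS _ disjoint_family_top_set[OF I(1)]]) (rule image_subsetI, rule E)
  also have "\<dots> = (\<Sum>B\<in>?S. 1 / real ((card K + card J) choose b))"
  proof (rule sum.cong[OF refl])
    fix B assume "B \<in> ?S"
    then show "prob (?E B) = 1 / real ((card K + card J) choose b)"
      using prob_top_set[OF ex I(1) noties, of B] I(2) by (simp add: le_supI1)
  qed
  also have "\<dots> = real (card K choose b) / real ((card K + card J) choose b)"
    using n_subsets[OF fin(1)] by simp
  finally show ?thesis .
qed

subsection \<open>Exchangeability of the conformity scores\<close>

text \<open>Doob-Dynkin factorisation. Each rational sublevel set of \<open>f\<close> is the
  preimage of some \<open>B q\<close>, and the infimum of the \<open>q\<close> with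
  \<open>h x\<close> in \<open>B q\<close> recovers \<open>f x\<close>.\<close>

lemma borel_measurable_vimage_algebra_factor:
  fixes f :: "'a \<Rightarrow> real"
  assumes h: "h \<in> X \<rightarrow> space K" and f: "f \<in> borel_measurable (vimage_algebra X h K)"
  shows "\<exists>g \<in> borel_measurable K. \<forall>x\<in>X. f x = g (h x)"
proof -
  have "\<exists>B \<in> sets K. {x \<in> X. f x < real_of_rat q} = h -` B \<inter> X" for q
  proof -
    have "{x \<in> space (vimage_algebra X h K). f x < real_of_rat q} \<in> sets (vimage_algebra X h K)"
      using f by measurable
    then show ?thesis unfolding sets_vimage_algebra2[OF h] by auto
  qed
  then obtain B where B: "\<And>q. B q \<in> sets K" "\<And>q. {x \<in> X. f x < real_of_rat q} = h -` B q \<inter> X"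
    by metis
  \<comment> \<open>Off the image of \<open>h\<close> the infimum may be infinite, hence the detour
    through \<open>ereal\<close>.\<close>
  define G where "G z = (INF q. if z \<in> B q then ereal (real_of_rat q) else \<infinity>)" for z
  have "G \<in> borel_measurable K"
    unfolding G_def using B(1) by measurable
  moreover have "G (h x) = ereal (f x)" if "x \<in> X" for x
  proof (rule antisym)
    have mem: "h x \<in> B q \<longleftrightarrow> f x < real_of_rat q" for q using B(2)[of q] that by blast
    show "ereal (f x) \<le> G (h x)"
      unfolding G_def by (intro INF_greatest) (simp add: mem)
    show "G (h x) \<le> ereal (f x)"
    proof (rule ccontr)
      assume "\<not> G (h x) \<le> ereal (f x)"
      then obtain q where q: "ereal (f x) < ereal (real_of_rat q)" "ereal (real_of_rat q) < G (h x)"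
        using ereal_dense3[of "ereal (f x)" "G (h x)"] unfolding not_le by blast
      have "G (h x) \<le> ereal (real_of_rat q)"
        unfolding G_def using q(1) by (intro INF_lower2[of q]) (simp_all add: mem)
      with q(2) show False by simp
    qed
  qed
  ultimately show ?thesis by (intro bexI[of _ "\<lambda>z. real_of_ereal (G z)"]) auto
qed

text \<open>Reduces to the previous factorisation through \<open>H\<close>, the product of the
  identity and \<open>h\<close>, because the sigma-algebra generated by \<open>H\<close> contains
  the product one.\<close>

lemma borel_measurable_pair_vimage_algebra_factor:
  fixes f :: "'a \<times> 'w \<Rightarrow> real"
  assumes h: "h \<in> X \<rightarrow> space K" and f: "f \<in> borel_measurable (N \<Otimes>\<^sub>M vimage_algebra X h K)"
  shows "\<exists>g \<in> borel_measurable (N \<Otimes>\<^sub>M K). \<forall>x\<in>space N. \<forall>\<omega>\<in>X. f (x, \<omega>) = g (x, h \<omega>)"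
proof -
  define H where "H = (\<lambda>(x, \<omega>). (x :: 'a, h \<omega>))"
  let ?V = "vimage_algebra (space N \<times> X) H (N \<Otimes>\<^sub>M K)"
  have H: "H \<in> space N \<times> X \<rightarrow> space (N \<Otimes>\<^sub>M K)"
    using h by (auto simp: H_def space_pair_measure)
  have Hm: "H \<in> measurable ?V (N \<Otimes>\<^sub>M K)" by (rule measurable_vimage_algebra1[OF H])
  have 1: "fst \<in> measurable ?V N"
    using measurable_compose[OF Hm measurable_fst] by (simp add: H_def split_beta)
  have 2: "snd \<in> measurable ?V (vimage_algebra X h K)"
  proof (rule measurable_vimage_algebra2)
    show "snd \<in> space ?V \<rightarrow> X" by auto
    show "(\<lambda>x. h (snd x)) \<in> measurable ?V K"
      using measurable_compose[OF Hm measurable_snd] by (simp add: H_def split_beta)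
  qed
  have "(\<lambda>x. x) \<in> measurable ?V (N \<Otimes>\<^sub>M vimage_algebra X h K)"
    using measurable_Pair[OF 1 2] by simp
  from measurable_compose[OF this f] have "f \<in> borel_measurable ?V" .
  from borel_measurable_vimage_algebra_factor[OF H this] show ?thesis
    by (auto simp: H_def)
qed

text \<open>Factoring \<open>\<rho>\<close> through the training sample makes the first
  \<open>N\<close> scores a fixed measurable map \<open>G N\<close> of the first
  \<open>t + N\<close> data. A permutation of the scores then lifts to a permutation of the data
  that fixes the training sample.\<close>

lemma exchangeable_conformity_score:
  fixes X :: "int \<Rightarrow> 'w \<Rightarrow> real ^ 'd"
  assumes ex: "exchangeable M (pair_algebra \<Y>) (data_seq t X Y)"
    and jm: "jointly_measurable M \<Y> t X Y \<rho>"
  shows "exchangeable M borel (\<lambda>j. conformity_score X Y \<rho> (int j + 1))"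
proof -
  let ?P = "pair_algebra \<Y> :: ((real ^ 'd) \<times> real) measure"
  let ?I = "{- int t + 1..0}"
  let ?K = "PiM ?I (\<lambda>_. ?P)"
  define W where "W = data_seq t X Y"
  define V where "V = (\<lambda>j. conformity_score X Y \<rho> (int j + 1))"
  have W[measurable]: "W j \<in> measurable M ?P" for j using ex by (simp add: exchangeable_def W_def)
  \<comment> \<open>Training index \<open>i\<close> has position \<open>i + t - 1\<close> in
    \<open>W\<close>; the score \<open>V j\<close> belongs to position \<open>t + j\<close>.\<close>
  have tr: "training_sample t X Y \<omega> = (\<lambda>i\<in>?I. W (nat (i + int t - 1)) \<omega>)" for \<omega>
    by (auto simp: training_sample_def W_def data_seq_def restrict_def)
  have "training_sample t X Y \<in> measurable M ?K"
    unfolding tr[abs_def] by measurable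
  then have trs: "training_sample t X Y \<in> space M \<rightarrow> space ?K" by (rule measurable_space[THEN funcsetI])
  obtain g where g[measurable]: "g \<in> borel_measurable (?P \<Otimes>\<^sub>M ?K)"
    and g_eq: "\<And>z \<omega>. z \<in> space ?P \<Longrightarrow> \<omega> \<in> space M \<Longrightarrow> \<rho> (fst z) (snd z) \<omega> = g (z, training_sample t X Y \<omega>)"
    using borel_measurable_pair_vimage_algebra_factor[OF trs jm[unfolded jointly_measurable_def training_algebra_def]]
    by (auto simp: split_beta)
  define G where "G N w = (\<lambda>j\<in>{..<N}. g (w (t + j), \<lambda>i\<in>?I. w (nat (i + int t - 1))))"
    for N :: nat and w :: "nat \<Rightarrow> (real ^ 'd) \<times> real"
  have V_eq: "V j \<omega> = g (W (t + j) \<omega>, \<lambda>i\<in>?I. W (nat (i + int t - 1)) \<omega>)" if "\<omega> \<in> space M" for j \<omega>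
    using g_eq[OF measurable_space[OF W that, of "t + j"] that]
    by (simp add: V_def conformity_score_def tr) (simp add: W_def data_seq_def add.commute)
  have V: "V j \<in> borel_measurable M" for j
  proof -
    have "(\<lambda>\<omega>. g (W (t + j) \<omega>, \<lambda>i\<in>?I. W (nat (i + int t - 1)) \<omega>)) \<in> borel_measurable M"
      by measurable
    then show ?thesis by (rule measurable_cong[THEN iffD2, rotated]) (rule V_eq)
  qed
  have G: "G N \<in> measurable (PiM {..<t + N} (\<lambda>_. ?P)) (PiM {..<N} (\<lambda>_. borel))" for N
  proof -
    have "(\<lambda>w. w (t + j)) \<in> measurable (PiM {..<t + N} (\<lambda>_. ?P)) ?P" if "j < N" for j
      using that by (intro measurable_component_singleton) auto
    moreover have "(\<lambda>w. \<lambda>i\<in>?I. w (nat (i + int t - 1))) \<in> measurable (PiM {..<t + N} (\<lambda>_. ?P)) ?K"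
      by (intro measurable_restrict measurable_component_singleton) auto
    ultimately show ?thesis
      unfolding G_def by (intro measurable_restrict measurable_compose[OF _ g] measurable_Pair) auto
  qed
  have "distr M (PiM {..<N} (\<lambda>_. borel)) (\<lambda>\<omega>. \<lambda>j\<in>{..<N}. V (\<pi> j) \<omega>) =
      distr M (PiM {..<N} (\<lambda>_. borel)) (\<lambda>\<omega>. \<lambda>j\<in>{..<N}. V j \<omega>)"
    if N: "N \<ge> 1" and \<pi>: "\<pi> permutes {..<N}" for N \<pi>
  proof -
    let ?W = "\<lambda>\<sigma> \<omega>. \<lambda>j\<in>{..<t + N}. W (\<sigma> j) \<omega>"
    let ?Q = "PiM {..<t + N} (\<lambda>_. ?P)"
    \<comment> \<open>Shifts \<open>\<pi>\<close> past the training positions and leaves these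
      fixed.\<close>
    define ext where "ext \<pi> j = (if j < t then j else t + \<pi> (j - t))" for \<pi> :: "nat \<Rightarrow> nat" and j
    have "ext \<pi> permutes {..<t + N}"
    proof (rule bij_imp_permutes)
      show "ext \<pi> j = j" if "j \<notin> {..<t + N}" for j
        using that permutes_not_in[OF \<pi>, of "j - t"] by (auto simp: ext_def)
      show "bij_betw (ext \<pi>) {..<t + N} {..<t + N}"
      proof (rule bij_betw_byWitness[where f' = "ext (inv \<pi>)"])
        have "ext \<tau> ` {..<t + N} \<subseteq> {..<t + N}" if "\<tau> permutes {..<N}" for \<tau>
        proof (rule image_subsetI)
          fix j assume "j \<in> {..<t + N}"
          then have "\<not> j < t \<Longrightarrow> \<tau> (j - t) < N"
            using permutes_in_image[OF that, of "j - t"] by simp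
          then show "ext \<tau> j \<in> {..<t + N}" by (auto simp: ext_def)
        qed
        then show "ext \<pi> ` {..<t + N} \<subseteq> {..<t + N}" "ext (inv \<pi>) ` {..<t + N} \<subseteq> {..<t + N}"
          using \<pi> permutes_inv[OF \<pi>] by blast+
      qed (auto simp: ext_def permutes_inverses[OF \<pi>])
    qed
    then have W_ex: "distr M ?Q (?W (ext \<pi>)) = distr M ?Q (?W (\<lambda>j. j))"
      using ex N by (simp add: exchangeable_def W_def)
    \<comment> \<open>Both laws to be compared are images under \<open>G N\<close> of laws of the
      first \<open>t + N\<close> data, which agree by exchangeability.\<close>
    have key: "distr M (PiM {..<N} (\<lambda>_. borel)) (\<lambda>\<omega>. \<lambda>j\<in>{..<N}. V (\<tau> j) \<omega>) =
        distr (distr M ?Q (?W \<sigma>)) (PiM {..<N} (\<lambda>_. borel)) (G N)"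
      if "\<And>j. j < t \<Longrightarrow> \<sigma> j = j" "\<And>j. \<sigma> (t + j) = t + \<tau> j" for \<tau> \<sigma>
    proof -
      have "?W \<sigma> \<in> measurable M ?Q" by measurable
      then have "distr (distr M ?Q (?W \<sigma>)) (PiM {..<N} (\<lambda>_. borel)) (G N) =
          distr M (PiM {..<N} (\<lambda>_. borel)) (G N \<circ> ?W \<sigma>)"
        by (intro distr_distr G)
      also have "\<dots> = distr M (PiM {..<N} (\<lambda>_. borel)) (\<lambda>\<omega>. \<lambda>j\<in>{..<N}. V (\<tau> j) \<omega>)"
      proof (rule distr_cong[OF refl refl])
        fix \<omega> assume "\<omega> \<in> space M"
        moreover have "(\<lambda>i\<in>?I. ?W \<sigma> \<omega> (nat (i + int t - 1))) = (\<lambda>i\<in>?I. W (nat (i + int t - 1)) \<omega>)"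
          using that(1) by (intro restrict_ext) auto
        ultimately show "(G N \<circ> ?W \<sigma>) \<omega> = (\<lambda>j\<in>{..<N}. V (\<tau> j) \<omega>)"
          unfolding comp_def G_def by (intro restrict_ext) (simp add: V_eq that(2))
      qed
      finally show ?thesis by (rule sym)
    qed
    show ?thesis
      using key[of "ext \<pi>" \<pi>] key[of "\<lambda>j. j" "\<lambda>j. j"] W_ex by (simp add: ext_def[abs_def])
  qed
  with V show ?thesis unfolding V_def exchangeable_def by blast
qed

subsection \<open>Empirical coverage\<close>

lemma (in prob_space) distributed_beta_of_moments:
  assumes C: "C \<in> borel_measurable M" and bnd: "AE \<omega> in M. \<bar>C \<omega>\<bar> \<le> 1" and ab: "0 < a" "0 < b"
    and mom: "\<And>r. expectation (\<lambda>\<omega>. C \<omega> ^ r) = Beta (a + real r) b / Beta a b"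
  shows "distributed M lborel C (\<lambda>x. ennreal (beta_density a b x))"
proof -
  have "distr M borel C = beta_distribution a b"
  proof (rule real_distribution_eq_of_moments)
    show "real_distribution (distr M borel C)" using C by (rule real_distribution_distr)
    show "AE x in distr M borel C. \<bar>x\<bar> \<le> 1" using C bnd by (simp add: AE_distr_iff)
    show "AE x in beta_distribution a b. \<bar>x\<bar> \<le> 1"
      using AE_beta_distribution by (rule eventually_mono) simp
    show "integral\<^sup>L (distr M borel C) (\<lambda>x. x ^ r) = integral\<^sup>L (beta_distribution a b) (\<lambda>x. x ^ r)" for r
      using C by (simp add: integral_distr mom beta_distribution_moment[OF ab])
  qed (rule real_distribution_beta[OF ab])
  \<comment> \<open>The reference measure \<open>lborel\<close> has the same measurable sets as
    \<open>borel\<close>.\<close>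
  moreover have "distr M lborel C = distr M borel C" by (rule distr_cong) simp_all
  ultimately show ?thesis using C by (simp add: distributed_def beta_distribution_def)
qed

text \<open>The \<open>k\<close>-th smallest calibration score sits at list position
  \<open>k - 1\<close>, so comparing a future score with it amounts to counting the calibration
  scores strictly below. As \<open>V\<close> starts at 0, future observable \<open>i\<close> has
  index \<open>n + i - 1\<close>.\<close>

lemma coverage_indicator_eq:
  fixes X :: "int \<Rightarrow> 'w \<Rightarrow> real ^ 'd" and \<rho> :: "real ^ 'd \<Rightarrow> real \<Rightarrow> 'w \<Rightarrow> real"
  assumes "Y (int n + int i) \<omega> \<in> \<Y>" and "quantile_rank n \<alpha> = int k" "1 \<le> k" "k \<le> n" "1 \<le> i"
  defines "V \<equiv> \<lambda>j. conformity_score X Y \<rho> (int j + 1)"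
  shows "coverage_indicator \<Y> n \<alpha> X Y \<rho> i \<omega> =
    (if card {j\<in>{..<n}. V j \<omega> < V (n + i - 1) \<omega>} < k then 1 else 0)"
proof -
  let ?y = "conformity_score X Y \<rho> (int n + int i) \<omega>"
  let ?xs = "map (\<lambda>i. conformity_score X Y \<rho> i \<omega>) [1..int n]"
  have y: "?y = V (n + i - 1) \<omega>" using assms(5) by (simp add: V_def of_nat_diff)
  have "?xs = map (\<lambda>j. V j \<omega>) [0..<n]"
    by (rule nth_equalityI) (simp_all add: V_def add.commute)
  then have "length (filter (\<lambda>x. x < ?y) ?xs) = length (filter (\<lambda>j. V j \<omega> < ?y) [0..<n])"
    by (simp add: filter_map comp_def)
  also have "\<dots> = card {j\<in>{..<n}. V j \<omega> < ?y}"
    by (subst distinct_card[symmetric]) (auto intro!: arg_cong[where f = card])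
  finally have len: "length (filter (\<lambda>x. x < ?y) ?xs) = card {j\<in>{..<n}. V j \<omega> < ?y}" .
  have "?y \<le> sort ?xs ! (k - 1) \<longleftrightarrow> length (filter (\<lambda>x. x < ?y) ?xs) \<le> k - 1"
    using assms(3,4) by (intro sort_nth_ge_iff) simp
  also have "\<dots> \<longleftrightarrow> card {j\<in>{..<n}. V j \<omega> < ?y} < k"
    unfolding len using assms(3) by linarith
  finally have "?y \<le> calibration_order_stat n X Y \<rho> (int k) \<omega> \<longleftrightarrow> card {j\<in>{..<n}. V j \<omega> < ?y} < k"
    using assms(3) by (simp add: calibration_order_stat_def nat_diff_distrib)
  then show ?thesis
    using assms(1,2) by (simp add: coverage_indicator_def prediction_set_def conformity_score_def[symmetric] y)
qed

theorem theorem2: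
  fixes M :: "'w measure"
    and \<Y> :: "real set"
    and X :: "int \<Rightarrow> 'w \<Rightarrow> real ^ 'd"
    and Y :: "int \<Rightarrow> 'w \<Rightarrow> real"
    and \<rho> :: "real ^ 'd \<Rightarrow> real \<Rightarrow> 'w \<Rightarrow> real"
    and t n :: nat
    and \<alpha> :: real
  assumes "prob_space M"
    and "response_space \<Y>"
    and "t \<ge> 1" and "n \<ge> 1"
    and "0 < \<alpha>" and "\<alpha> < 1"
    and "feasible n \<alpha>"
    and "exchangeable M (pair_algebra \<Y>) (data_seq t X Y)"
    and "conformity_function M \<Y> t X Y \<rho>"
    and "jointly_measurable M \<Y> t X Y \<rho>"
    and "regular_conformity M X Y \<rho>"
  shows "\<exists>C :: 'w \<Rightarrow> real.
      (AE \<omega> in M. (\<lambda>m. empirical_coverage \<Y> n \<alpha> X Y \<rho> m \<omega>) \<longlonglongrightarrow> C \<omega>) \<and>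
      distributed M lborel C
        (\<lambda>x. ennreal (beta_density (real_of_int \<lceil>(1 - \<alpha>) * (real n + 1)\<rceil>)
                                   (real_of_int \<lfloor>\<alpha> * (real n + 1)\<rfloor>) x))"
proof -
  interpret prob_space M by fact
  define k where "k = nat (quantile_rank n \<alpha>)"
  have "0 < quantile_rank n \<alpha>" using \<open>\<alpha> < 1\<close> by (simp add: quantile_rank_def)
  then have k: "quantile_rank n \<alpha> = int k" "1 \<le> k" "k \<le> n"
    using \<open>feasible n \<alpha>\<close> by (auto simp: k_def feasible_def)
  define b where "b = n + 1 - k"
  have b: "1 \<le> b" "b \<le> n" "n + 1 - b = k" using k by (auto simp: b_def)
  \<comment> \<open>Since \<open>n + 1\<close> is an integer, subtraction turns the ceiling into the
    floor: the second Beta parameter is \<open>b\<close>.\<close>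
  have "\<alpha> * (real n + 1) = (real n + 1) - (1 - \<alpha>) * (real n + 1)" by algebra
  also have "\<lfloor>\<dots>\<rfloor> = int n + 1 - \<lceil>(1 - \<alpha>) * (real n + 1)\<rceil>" by linarith
  finally have floor: "real_of_int \<lfloor>\<alpha> * (real n + 1)\<rfloor> = real b"
    using k by (simp add: quantile_rank_def b_def of_nat_diff)
  have ceil: "real_of_int \<lceil>(1 - \<alpha>) * (real n + 1)\<rceil> = real k"
    using k(1) by (simp add: quantile_rank_def)

  define V where "V = (\<lambda>j. conformity_score X Y \<rho> (int j + 1))"
  have ex: "exchangeable M borel V"
    unfolding V_def by (rule exchangeable_conformity_score) fact+
  then have V: "V j \<in> borel_measurable M" for j by (simp add: exchangeable_def)
  have noties: "AE \<omega> in M. inj (\<lambda>i. V i \<omega>)"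
    using \<open>regular_conformity M X Y \<rho>\<close> unfolding regular_conformity_def
  proof (rule eventually_mono)
    fix \<omega> assume *: "\<forall>i\<ge>1. \<forall>j\<ge>1. i \<noteq> j \<longrightarrow> conformity_score X Y \<rho> i \<omega> \<noteq> conformity_score X Y \<rho> j \<omega>"
    show "inj (\<lambda>i. V i \<omega>)"
    proof (rule injI)
      fix i j assume "V i \<omega> = V j \<omega>"
      with *[rule_format, of "int i + 1" "int j + 1"] show "i = j" by (auto simp: V_def)
    qed
  qed
  \<comment> \<open>\<open>E i\<close> is the coverage of future observable \<open>i + 1\<close>,
    since \<open>V (n + i)\<close> is the score with index \<open>n + i + 1\<close>.\<close>
  define E where "E i = {\<omega> \<in> space M. card {j\<in>{..<n}. V j \<omega> < V (n + i) \<omega>} < k}" for i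
  have E: "E i \<in> events" for i unfolding E_def by (rule lower_count_measurable[OF V]) simp
  define p where "p r = real (n choose b) / real ((n + r) choose b)" for r
  have p: "prob {\<omega> \<in> space M. \<forall>i\<in>A. \<omega> \<in> E i} = p (card A)" if "finite A" for A
  proof -
    have "{\<omega> \<in> space M. \<forall>i\<in>A. \<omega> \<in> E i} =
        {\<omega> \<in> space M. \<forall>i\<in>(+) n ` A. card {j\<in>{..<n}. V j \<omega> < V i \<omega>} < card {..<n} + 1 - b}"
      using b(3) by (auto simp: E_def)
    also have "prob \<dots> = real (card {..<n} choose b) / real ((card {..<n} + card ((+) n ` A)) choose b)"
      using that b by (intro prob_covered[OF ex noties]) auto
    finally show ?thesis by (simp add: p_def card_image)
  qed
  have p1: "prob (E i) = p 1" for i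
    using p[of "{i}"] sets.sets_into_space[OF E[of i]] by (simp add: Int_def[symmetric] Int_absorb1 Collect_conj_eq)
  have p2: "prob (E i \<inter> E j) = p 2" if "i \<noteq> j" for i j
  proof -
    have "{\<omega> \<in> space M. \<forall>i\<in>{i, j}. \<omega> \<in> E i} = E i \<inter> E j"
      using sets.sets_into_space[OF E[of i]] by auto
    with p[of "{i, j}"] that show ?thesis by (simp add: numeral_2_eq_2)
  qed

  \<comment> \<open>Taking \<open>lim\<close> pointwise gives a measurable function; its values
    where the averages diverge concern only a null set.\<close>
  define C where "C \<omega> = lim (\<lambda>m. (\<Sum>i<m. indicator (E i) \<omega> :: real) / real m)" for \<omega>
  have C: "C \<in> borel_measurable M"
    unfolding C_def
    by (intro borel_measurable_lim_metric borel_measurable_divide borel_measurable_sum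
        borel_measurable_indicator borel_measurable_const E)
  have lim: "AE \<omega> in M. (\<lambda>m. (\<Sum>i<m. indicator (E i) \<omega> :: real) / real m) \<longlonglongrightarrow> C \<omega>"
    using AE_convergent_averages[OF E p1 p2] by (simp add: C_def convergent_LIMSEQ_iff)
  have cov: "empirical_coverage \<Y> n \<alpha> X Y \<rho> m \<omega> = (\<Sum>i<m. indicator (E i) \<omega>) / real m"
    if \<omega>: "\<omega> \<in> space M" for m \<omega>
  proof -
    have "coverage_indicator \<Y> n \<alpha> X Y \<rho> (Suc i) \<omega> = indicator (E i) \<omega>" for i
    proof -
      \<comment> \<open>Measurability of the data, part of exchangeability, places every response in
        \<Y>, so membership in the prediction set is just the score inequality.\<close>
      have "data_seq t X Y (t + n + i) \<in> measurable M (pair_algebra \<Y>)"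
        using \<open>exchangeable M (pair_algebra \<Y>) (data_seq t X Y)\<close> by (simp add: exchangeable_def)
      from measurable_space[OF this \<omega>] have "Y (int n + int (Suc i)) \<omega> \<in> \<Y>"
        by (simp add: data_seq_def pair_algebra_def response_algebra_def space_pair_measure
            space_restrict_space add_ac)
      from coverage_indicator_eq[where X = X and Y = Y and \<rho> = \<rho> and \<omega> = \<omega> and i = "Suc i", OF this k] \<omega>
      show ?thesis
        by (simp add: E_def V_def)
    qed
    then show ?thesis by (simp add: empirical_coverage_def sum.atLeast1_atMost_eq)
  qed
  have bnd: "AE \<omega> in M. \<bar>C \<omega>\<bar> \<le> 1"
    using lim
  proof eventually_elim
    case (elim \<omega>)
    have "\<bar>(\<Sum>i<m. indicator (E i) \<omega> :: real) / real m\<bar> \<le> 1" for m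
      using sum_bounded_above[of "{..<m}" "\<lambda>i. indicator (E i) \<omega> :: real" 1]
      by (auto simp: divide_simps abs_of_nonneg sum_nonneg)
    then show ?case by (intro LIMSEQ_le_const2[OF tendsto_rabs[OF elim]]) auto
  qed
  have "distributed M lborel C (\<lambda>x. ennreal (beta_density (real k) (real b) x))"
  proof (rule distributed_beta_of_moments[OF C bnd])
    \<comment> \<open>The moment \<open>p r\<close> found by counting is the Beta moment with
      parameters \<open>k = n + 1 - b\<close> and \<open>b\<close>.\<close>
    show "expectation (\<lambda>\<omega>. C \<omega> ^ r) = Beta (real k + real r) (real b) / Beta (real k) (real b)" for r
      using limit_average_moments[OF E p lim C, of r] Beta_quotient_binomial[OF b(1,2), of r]
      by (simp only: p_def b(3))
  qed (use k b in auto)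
  moreover have "AE \<omega> in M. (\<lambda>m. empirical_coverage \<Y> n \<alpha> X Y \<rho> m \<omega>) \<longlonglongrightarrow> C \<omega>"
    using lim AE_space by eventually_elim (simp add: cov)
  ultimately show ?thesis unfolding floor ceil by blast
qed

end
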